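(* Let $G$ be a finite simple bipartite graph with vertices $v_1,\dots,v_n$ and let $I$ be an independent set of vertices of $G$. Then $$\frac{1}{2}\mathcal{E}(G)\geq\sum_{v_i\in I}\mathcal{E}_G(v_i).$$
   Context: Let $A$ be the adjacency matrix of $G$ and $|A|=(AA^* )^{1/2}$. The energy of the vertex $v_i$ is $\mathcal{E}_G(v_i)=|A|_{ii}$. The energy of $G$ is $\mathcal{E}(G)=\sum_{i=1}^n|\lambda_i|=\mathrm{Tr}(|A|)=\sum_{i=1}^n\mathcal{E}_G(v_i)$, where $\lambda_1,\dots,\lambda_n$ are the eigenvalues of $A$ with multiplicity. An independent set is a set of vertices no two of which are adjacent. *)

theory Defs
  imports
    "Graph_Theory.Pair_Digraph"
    "Jordan_Normal_Form.Schur_Decomposition"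
    "Jordan_Normal_Form.Spectral_Radius"
begin

text \<open>
  A finite simple graph is a \<open>pair_graph\<close>: a finite, symmetric, loop-free digraph without
  parallel arcs, in which the undirected edge joining \<open>u\<close> and \<open>w\<close> is represented by the two arcs
  \<open>(u, w)\<close> and \<open>(w, u)\<close>.
\<close>

definition independent_set :: "'a pair_pre_digraph \<Rightarrow> 'a set \<Rightarrow> bool" where
  "independent_set G I \<longleftrightarrow> I \<subseteq> pverts G \<and> (\<forall>u\<in>I. \<forall>w\<in>I. (u, w) \<notin> parcs G)"

definition bipartite :: "'a pair_pre_digraph \<Rightarrow> bool" where
  "bipartite G \<longleftrightarrow>
     (\<exists>X Y. X \<union> Y = pverts G \<and> X \<inter> Y = {} \<and> independent_set G X \<and> independent_set G Y)"

text \<open>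
  The list \<open>vs\<close> enumerates the vertices (from index 0) and thus fixes the order of the rows and
  columns.
\<close>

definition adjacency_mat :: "'a pair_pre_digraph \<Rightarrow> 'a list \<Rightarrow> complex mat" where
  "adjacency_mat G vs =
     mat (length vs) (length vs) (\<lambda>(i, j). if (vs ! i, vs ! j) \<in> parcs G then 1 else 0)"

definition psd_mat :: "complex mat \<Rightarrow> bool" where
  "psd_mat P \<longleftrightarrow> square_mat P \<and> mat_adjoint P = P \<and>
     (\<forall>x \<in> carrier_vec (dim_row P). 0 \<le> Re ((P *\<^sub>v x) \<bullet>c x))"

definition psd_sqrt :: "complex mat \<Rightarrow> complex mat" where
  "psd_sqrt M = (THE P. P \<in> carrier_mat (dim_row M) (dim_row M) \<and> psd_mat P \<and> P * P = M)"

definition abs_mat :: "complex mat \<Rightarrow> complex mat" where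
  "abs_mat A = psd_sqrt (A * mat_adjoint A)"

text \<open>The diagonal entries of the positive semidefinite matrix \<open>|A|\<close> are real, so \<open>Re\<close> is only
  a coercion to the reals here.\<close>

definition vertex_energy :: "'a pair_pre_digraph \<Rightarrow> 'a list \<Rightarrow> nat \<Rightarrow> real" where
  "vertex_energy G vs i = Re (abs_mat (adjacency_mat G vs) $$ (i, i))"

text \<open>The sum of the absolute values of the eigenvalues, each counted with its multiplicity as a
  root of the characteristic polynomial.\<close>

definition graph_energy :: "'a pair_pre_digraph \<Rightarrow> 'a list \<Rightarrow> real" where
  "graph_energy G vs =
     (let A = adjacency_mat G vs
      in \<Sum>\<mu>\<in>spectrum A. real (order \<mu> (char_poly A)) * cmod \<mu>)"

end

theory Submission
  imports Defs
begin

text \<open>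
  Let \<open>P\<close> be the coordinate projection onto the vertices of an independent set \<open>I\<close>. Independence
  says that \<open>P A P = 0\<close>, and the sum of the vertex energies over \<open>I\<close> is the trace of \<open>P |A|\<close>. Let
  \<open>S\<close> be the sign of \<open>A\<close>, so that \<open>|A| = A S = S A\<close>, and let \<open>R = 2 P - 1\<close>, a self-adjoint unitary
  matrix. Because \<open>P A P = 0\<close>, expanding the product gives \<open>R A R = A - 2 P A - 2 A P\<close>, and therefore
  \<open>Tr (R A R S) = Tr |A| - 4 Tr (P |A|)\<close>. On the other hand \<open>R S R\<close> is a contraction, hence
  \<open>Tr (R A R S) = Tr (A R S R)\<close> is at least \<open>- Tr |A|\<close>. Together these two facts give
  \<open>2 Tr (P |A|) \<le> Tr |A|\<close>, which is the claim.

  The trace estimate is carried out in an orthonormal eigenbasis \<open>u k\<close> of \<open>A\<close> with eigenvalues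
  \<open>d k\<close>, where it becomes a statement about the real numbers \<open>d k\<close>, \<open>sgn (d l)\<close> and the squared
  moduli of the entries of \<open>P\<close> in that basis (\<open>weighted_sum_le_half\<close>, applied in
  \<open>trace_abs_isotropic_le_half\<close>). The eigenbasis comes from the spectral theorem
  (\<open>hermitian_spectral_decomposition\<close>). Two more facts translate the energies: \<open>|A|\<close> has the
  same eigenvectors with eigenvalues \<open>|d k|\<close>, which needs the uniqueness of positive semidefinite
  square roots (\<open>abs_spectral_mat\<close>), and the roots of the characteristic polynomial, with
  multiplicity, are the numbers \<open>d k\<close> (\<open>sum_spectrum_spectral_mat\<close>).
\<close>

section \<open>Adjoints, unitary matrices and real diagonal matrices\<close>

lemma adjoint_index [simp]:
  "i < dim_col A \<Longrightarrow> j < dim_row A \<Longrightarrow> mat_adjoint A $$ (i, j) = conjugate (A $$ (j, i))"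
  unfolding mat_adjoint_def by (auto simp: mat_of_rows_def)

lemma adjoint_dim [simp]:
  "dim_row (mat_adjoint A) = dim_col A" "dim_col (mat_adjoint A) = dim_row A"
  unfolding mat_adjoint_def by auto

lemma adjoint_carrier [simp]: "A \<in> carrier_mat m n \<Longrightarrow> mat_adjoint A \<in> carrier_mat n m"
  by (metis adjoint_dim carrier_matD carrier_matI)

lemma adjoint_adjoint [simp]: "mat_adjoint (mat_adjoint A) = A"
  by (rule eq_matI) auto

lemma adjoint_mult:
  fixes A B :: "complex mat"
  assumes "A \<in> carrier_mat m n" "B \<in> carrier_mat n k"
  shows "mat_adjoint (A * B) = mat_adjoint B * mat_adjoint A"
  using assms
  by (intro eq_matI) (auto simp: scalar_prod_def conjugate_complex_def mult.commute intro!: sum.cong)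

lemma adjoint_four_block:
  fixes A B C D :: "complex mat"
  assumes "A \<in> carrier_mat m1 n1" "B \<in> carrier_mat m1 n2"
    "C \<in> carrier_mat m2 n1" "D \<in> carrier_mat m2 n2"
  shows "mat_adjoint (four_block_mat A B C D) =
    four_block_mat (mat_adjoint A) (mat_adjoint C) (mat_adjoint B) (mat_adjoint D)"
  using assms by (intro eq_matI) auto

lemma square_mult_carrier [simp]:
  "A \<in> carrier_mat n n \<Longrightarrow> B \<in> carrier_mat n n \<Longrightarrow> A * B \<in> carrier_mat n n"
  by simp

lemma mult_block_diag:
  fixes A A' B B' :: "complex mat"
  assumes "A \<in> carrier_mat m m" "A' \<in> carrier_mat m m" "B \<in> carrier_mat k k" "B' \<in> carrier_mat k k"
  shows "four_block_mat A (0\<^sub>m m k) (0\<^sub>m k m) B * four_block_mat A' (0\<^sub>m m k) (0\<^sub>m k m) B' =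
    four_block_mat (A * A') (0\<^sub>m m k) (0\<^sub>m k m) (B * B')"
  using assms by (subst mult_four_block_mat[of _ m m _ k _ k _ _ m _ k]) auto

definition unitary :: "nat \<Rightarrow> complex mat \<Rightarrow> bool" where
  "unitary n U \<longleftrightarrow> U \<in> carrier_mat n n \<and> mat_adjoint U * U = 1\<^sub>m n"

lemma unitaryD:
  assumes "unitary n U"
  shows "U \<in> carrier_mat n n" "mat_adjoint U * U = 1\<^sub>m n" "U * mat_adjoint U = 1\<^sub>m n"
  using assms mat_mult_left_right_inverse[of "mat_adjoint U" n U] by (auto simp: unitary_def)

lemma unitary_mult:
  assumes "unitary n U" "unitary n V"
  shows "unitary n (U * V)"
proof -
  note U = unitaryD[OF assms(1)] and V = unitaryD[OF assms(2)]
  have "mat_adjoint (U * V) * (U * V) = mat_adjoint V * (mat_adjoint U * U) * V"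
    using U(1) V(1) by (simp add: adjoint_mult[of _ n n _ n] assoc_mult_mat[of _ n n _ n _ n])
  also have "\<dots> = 1\<^sub>m n" using U V by (simp add: right_mult_one_mat[of _ n n])
  finally show ?thesis using U(1) V(1) by (auto simp: unitary_def)
qed

lemma unitary_col_orthonormal:
  assumes "unitary n U" "k < n" "l < n"
  shows "(\<Sum>i<n. cnj (U $$ (i, k)) * U $$ (i, l)) = (if k = l then 1 else 0)"
proof -
  note U = unitaryD[OF assms(1)]
  have "(\<Sum>i<n. cnj (U $$ (i, k)) * U $$ (i, l)) = (mat_adjoint U * U) $$ (k, l)"
    using U(1) assms(2,3)
    by (auto simp: scalar_prod_def conjugate_complex_def atLeast0LessThan intro!: sum.cong)
  then show ?thesis using U(2) assms(2,3) by simp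
qed

lemma unitary_row_orthonormal:
  assumes "unitary n U" "i < n" "j < n"
  shows "(\<Sum>k<n. U $$ (i, k) * cnj (U $$ (j, k))) = (if i = j then 1 else 0)"
proof -
  note U = unitaryD[OF assms(1)]
  have "(\<Sum>k<n. U $$ (i, k) * cnj (U $$ (j, k))) = (U * mat_adjoint U) $$ (i, j)"
    using U(1) assms(2,3)
    by (auto simp: scalar_prod_def conjugate_complex_def atLeast0LessThan intro!: sum.cong)
  then show ?thesis using U(3) assms(2,3) by simp
qed

definition real_diag :: "nat \<Rightarrow> (nat \<Rightarrow> real) \<Rightarrow> complex mat" where
  "real_diag n d = mat n n (\<lambda>(i, j). if i = j then complex_of_real (d i) else 0)"

lemma real_diag_carrier [simp]: "real_diag n d \<in> carrier_mat n n"
  by (simp add: real_diag_def)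

lemma adjoint_real_diag [simp]: "mat_adjoint (real_diag n d) = real_diag n d"
  by (rule eq_matI) (auto simp: real_diag_def conjugate_complex_def)

lemma mult_real_diag_index:
  assumes "A \<in> carrier_mat n n" "i < n" "j < n"
  shows "(A * real_diag n d) $$ (i, j) = A $$ (i, j) * d j"
    and "(real_diag n d * A) $$ (i, j) = d i * A $$ (i, j)"
  using assms
  by (auto simp: real_diag_def scalar_prod_def if_distrib if_distribR cong: if_cong)

lemma real_diag_mult: "real_diag n d * real_diag n e = real_diag n (\<lambda>i. d i * e i)"
proof (rule eq_matI)
  fix i j assume "i < dim_row (real_diag n (\<lambda>i. d i * e i))" "j < dim_col (real_diag n (\<lambda>i. d i * e i))"
  then have "i < n" "j < n" by (auto simp: real_diag_def)
  then show "(real_diag n d * real_diag n e) $$ (i, j) = real_diag n (\<lambda>i. d i * e i) $$ (i, j)"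
    by (simp only: mult_real_diag_index(1)[OF real_diag_carrier]) (auto simp: real_diag_def)
qed (auto simp: real_diag_def)

definition spectral_mat :: "nat \<Rightarrow> complex mat \<Rightarrow> (nat \<Rightarrow> real) \<Rightarrow> complex mat" where
  "spectral_mat n U d = U * real_diag n d * mat_adjoint U"

lemma spectral_mat_carrier [simp]: "U \<in> carrier_mat n n \<Longrightarrow> spectral_mat n U d \<in> carrier_mat n n"
  by (simp add: spectral_mat_def)

lemma spectral_mat_index:
  assumes "U \<in> carrier_mat n n" "i < n" "j < n"
  shows "spectral_mat n U d $$ (i, j) = (\<Sum>k<n. d k * (U $$ (i, k) * cnj (U $$ (j, k))))"
proof -
  have "spectral_mat n U d $$ (i, j) =
      (\<Sum>k<n. (U * real_diag n d) $$ (i, k) * cnj (U $$ (j, k)))"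
    using assms unfolding spectral_mat_def
    by (auto simp: scalar_prod_def conjugate_complex_def atLeast0LessThan real_diag_def
        intro!: sum.cong)
  also have "\<dots> = (\<Sum>k<n. d k * (U $$ (i, k) * cnj (U $$ (j, k))))"
    using assms by (intro sum.cong) (auto simp: mult_real_diag_index)
  finally show ?thesis .
qed

lemma adjoint_spectral_mat:
  assumes "U \<in> carrier_mat n n"
  shows "mat_adjoint (spectral_mat n U d) = spectral_mat n U d"
  using assms unfolding spectral_mat_def
  by (simp add: adjoint_mult[of _ n n _ n] assoc_mult_mat[of _ n n _ n _ n])

lemma spectral_mat_mult_unitary:
  assumes "unitary n U"
  shows "spectral_mat n U d * U = U * real_diag n d"
  using unitaryD[OF assms] unfolding spectral_mat_def
  by (simp add: assoc_mult_mat[of _ n n _ n _ n] right_mult_one_mat[of _ n n])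

lemma spectral_mat_mult:
  assumes "unitary n U"
  shows "spectral_mat n U d * spectral_mat n U e = spectral_mat n U (\<lambda>i. d i * e i)"
proof -
  note U = unitaryD[OF assms]
  have "spectral_mat n U d * spectral_mat n U e
      = (spectral_mat n U d * U) * real_diag n e * mat_adjoint U"
    using U(1) by (simp add: spectral_mat_def[of n U e] assoc_mult_mat[of _ n n _ n _ n])
  also have "\<dots> = U * (real_diag n d * real_diag n e) * mat_adjoint U"
    using U(1) by (simp add: spectral_mat_mult_unitary[OF assms] assoc_mult_mat[of _ n n _ n _ n])
  finally show ?thesis by (simp add: real_diag_mult spectral_mat_def)
qed

section \<open>The spectral theorem for Hermitian matrices\<close>

text \<open>
  Complete \<open>v\<close> to a basis and apply Gram--Schmidt, which keeps \<open>v\<close> as the first vector but does not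
  normalise; dividing the vectors by their lengths afterwards makes the matrix unitary and only
  rescales \<open>v\<close>.
\<close>

lemma unitary_with_first_col:
  assumes v: "v \<in> carrier_vec n" and v0: "v \<noteq> 0\<^sub>v n"
  obtains U c where "unitary n U" "col U 0 = c \<cdot>\<^sub>v v"
proof -
  interpret cof_vec_space n "TYPE(complex)" .
  define b where "b = basis_completion v"
  define ws where "ws = gram_schmidt n b"
  note bc = basis_completion[OF v v0, folded b_def]
  have n0: "n > 0" using v v0 by (cases n) auto
  obtain vs where bv: "b = v # vs" using bc(6,7) n0 by (cases b) auto
  have ws: "set ws \<subseteq> carrier_vec n" "corthogonal ws" "length ws = n"
    using gram_schmidt_result[OF bc(2,4,5) refl, folded ws_def] bc(6) by auto
  have hdws: "ws ! 0 = v"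
    using gram_schmidt_hd[OF v, of vs, folded bv ws_def] ws(3) n0 by (cases ws) auto
  have wsc: "ws ! k \<in> carrier_vec n" if "k < n" for k
    using ws that by auto
  define r where "r w = complex_of_real (1 / sqrt (Re (w \<bullet>c w)))" for w :: "complex vec"
  define U where "U = mat n n (\<lambda>(i, k). r (ws ! k) * ws ! k $ i)"
  have U: "U \<in> carrier_mat n n" by (simp add: U_def)
  have "(mat_adjoint U * U) $$ (k, l) = 1\<^sub>m n $$ (k, l)" if kl: "k < n" "l < n" for k l
  proof -
    have "(mat_adjoint U * U) $$ (k, l)
        = (\<Sum>i<n. cnj (r (ws ! k) * ws ! k $ i) * (r (ws ! l) * ws ! l $ i))"
      using kl by (auto simp: U_def scalar_prod_def conjugate_complex_def atLeast0LessThan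
          intro!: sum.cong)
    also have "\<dots> = r (ws ! k) * r (ws ! l) * (\<Sum>i<n. ws ! l $ i * cnj (ws ! k $ i))"
      by (simp add: sum_distrib_left sum_divide_distrib r_def mult_ac)
    also have "(\<Sum>i<n. ws ! l $ i * cnj (ws ! k $ i)) = ws ! l \<bullet>c ws ! k"
      using wsc[OF kl(1)] wsc[OF kl(2)]
      by (auto simp: scalar_prod_def conjugate_complex_def atLeast0LessThan intro!: sum.cong)
    finally have *: "(mat_adjoint U * U) $$ (k, l) = r (ws ! k) * r (ws ! l) * (ws ! l \<bullet>c ws ! k)" .
    show ?thesis
    proof (cases "k = l")
      case False
      then show ?thesis using * corthogonalD[OF ws(2), of l k] kl ws(3) by auto
    next
      case True
      define s where "s = ws ! k \<bullet>c ws ! k"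
      have "s \<noteq> 0" using corthogonalD[OF ws(2), of k k] kl ws(3) by (auto simp: s_def)
      moreover have "s \<ge> 0" unfolding s_def by (rule conjugate_square_ge_0_vec)
      ultimately have s: "s = complex_of_real (Re s)" "Re s > 0"
        by (auto simp: less_eq_complex_def complex_eq_iff)
      have "r (ws ! k) * r (ws ! k) * complex_of_real (Re s)
          = complex_of_real (1 / (sqrt (Re s) * sqrt (Re s)) * Re s)"
        unfolding r_def s_def[symmetric] by (simp only: of_real_mult[symmetric]) simp
      also have "\<dots> = 1" using s(2) by simp
      finally have "r (ws ! k) * r (ws ! k) * s = 1" by (subst s(1))
      then show ?thesis using * True kl by (simp add: s_def)
    qed
  qed
  then have "unitary n U" using U by (auto simp: unitary_def)
  moreover have "col U 0 = r v \<cdot>\<^sub>v v"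
    using n0 v by (intro eq_vecI) (auto simp: U_def hdws)
  ultimately show ?thesis by (rule that)
qed

text \<open>
  Deflation by induction on the dimension. In a unitary basis that starts with an eigenvector, the
  first column of the matrix is a multiple of the first unit vector; since the matrix stays Hermitian,
  so is the first row, and what remains is a smaller Hermitian block.
\<close>

theorem hermitian_spectral_decomposition:
  assumes "A \<in> carrier_mat n n" "mat_adjoint A = A"
  obtains U d where "unitary n U" "A = spectral_mat n U d"
proof -
  have "\<exists>U d. unitary n U \<and> A = spectral_mat n U d" using assms
  proof (induction n arbitrary: A)
    case 0
    then show ?case
      by (intro exI[of _ "1\<^sub>m 0"] exI[of _ "\<lambda>_. 0"])
        (auto simp: unitary_def spectral_mat_def intro!: eq_matI)
  next
    case (Suc m)
    let ?n = "Suc m"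
    note A = Suc.prems(1) and herm = Suc.prems(2)
    obtain e where "eigenvalue A e"
      using spectrum_non_empty[OF A] by (auto simp: spectrum_def)
    then obtain v where v: "v \<in> carrier_vec ?n" "v \<noteq> 0\<^sub>v ?n" "A *\<^sub>v v = e \<cdot>\<^sub>v v"
      using A by (auto simp: eigenvalue_def eigenvector_def)
    obtain U c where unU: "unitary ?n U" and col0: "col U 0 = c \<cdot>\<^sub>v v"
      using unitary_with_first_col[OF v(1,2)] by blast
    note U = unitaryD[OF unU]
    define B where "B = mat_adjoint U * A * U"
    have B: "B \<in> carrier_mat ?n ?n" using U A by (auto simp: B_def)
    have AB: "A = U * B * mat_adjoint U"
    proof -
      have "U * B * mat_adjoint U = (U * mat_adjoint U) * A * (U * mat_adjoint U)"
        using U(1) A by (simp add: B_def assoc_mult_mat[of _ ?n ?n _ ?n _ ?n])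
      then show ?thesis using U(3) A by simp
    qed
    have hermB: "mat_adjoint B = B"
      using U(1) A herm
      by (simp add: B_def adjoint_mult[of _ ?n ?n _ ?n] assoc_mult_mat[of _ ?n ?n _ ?n _ ?n])
    have "col B 0 = mat_adjoint U *\<^sub>v (A *\<^sub>v col U 0)"
    proof -
      have "col B 0 = col (mat_adjoint U * (A * U)) 0"
        using U(1) A by (simp add: B_def assoc_mult_mat[of _ ?n ?n _ ?n _ ?n])
      also have "\<dots> = mat_adjoint U *\<^sub>v col (A * U) 0"
        using U(1) A by (intro col_mult2[of _ ?n ?n _ ?n]) auto
      also have "col (A * U) 0 = A *\<^sub>v col U 0"
        using U(1) A by (intro col_mult2[of _ ?n ?n _ ?n]) auto
      finally show ?thesis .
    qed
    also have "A *\<^sub>v col U 0 = e \<cdot>\<^sub>v col U 0"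
      using A v by (simp add: col0 mult_mat_vec[of _ ?n ?n] smult_smult_assoc mult.commute)
    also have "mat_adjoint U *\<^sub>v (e \<cdot>\<^sub>v col U 0) = e \<cdot>\<^sub>v col (mat_adjoint U * U) 0"
    proof -
      have "col (mat_adjoint U * U) 0 = mat_adjoint U *\<^sub>v col U 0"
        using U(1) by (intro col_mult2[of _ ?n ?n _ ?n]) auto
      moreover have "mat_adjoint U *\<^sub>v (e \<cdot>\<^sub>v col U 0) = e \<cdot>\<^sub>v (mat_adjoint U *\<^sub>v col U 0)"
        using U(1) by (intro mult_mat_vec[of _ ?n ?n] adjoint_carrier col_carrier_vec) auto
      ultimately show ?thesis by simp
    qed
    finally have colB: "col B 0 = e \<cdot>\<^sub>v unit_vec ?n 0" by (simp add: U(2))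
    have B_0: "B $$ (i, 0) = (if i = 0 then e else 0)" if "i < ?n" for i
      using arg_cong[OF colB, of "\<lambda>w. w $ i"] that B by auto
    have B_sym: "B $$ (i, j) = cnj (B $$ (j, i))" if "i < ?n" "j < ?n" for i j
      using arg_cong[OF hermB, of "\<lambda>M. M $$ (i, j)"] that B by (auto simp: conjugate_complex_def)
    have e: "complex_of_real (Re e) = e"
      using B_sym[of 0 0] B_0[of 0] by (auto simp: complex_eq_iff)
    define C where "C = mat m m (\<lambda>(i, j). B $$ (Suc i, Suc j))"
    have C: "C \<in> carrier_mat m m" by (simp add: C_def)
    have "mat_adjoint C = C"
    proof (rule eq_matI)
      fix i j assume "i < dim_row C" "j < dim_col C"
      then show "mat_adjoint C $$ (i, j) = C $$ (i, j)"
        using B_sym[of "Suc i" "Suc j"] by (simp add: C_def conjugate_complex_def)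
    qed (auto simp: C_def)
    with Suc.IH[OF C] obtain V d where unV: "unitary m V" and CV: "C = spectral_mat m V d"
      by blast
    note V = unitaryD[OF unV]
    define F where "F = four_block_mat (1\<^sub>m 1) (0\<^sub>m 1 m) (0\<^sub>m m 1) V"
    have F: "F \<in> carrier_mat ?n ?n" using V(1) by (auto simp: F_def)
    have adj1: "mat_adjoint (1\<^sub>m 1 :: complex mat) = 1\<^sub>m 1" and
      adj0: "mat_adjoint (0\<^sub>m 1 m :: complex mat) = 0\<^sub>m m 1"
        "mat_adjoint (0\<^sub>m m 1 :: complex mat) = 0\<^sub>m 1 m"
      by (auto intro!: eq_matI simp: conjugate_complex_def)
    have adjF: "mat_adjoint F = four_block_mat (1\<^sub>m 1) (0\<^sub>m 1 m) (0\<^sub>m m 1) (mat_adjoint V)"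
      unfolding F_def using V(1) by (subst adjoint_four_block) (auto simp: adj1 adj0)
    have "mat_adjoint F * F = four_block_mat (1\<^sub>m 1) (0\<^sub>m 1 m) (0\<^sub>m m 1) (mat_adjoint V * V)"
      unfolding adjF unfolding F_def using V(1)
      by (simp add: mult_block_diag del: One_nat_def)
    then have unF: "unitary ?n F" using F V(2) by (simp add: unitary_def)
    define d' where "d' = case_nat (Re e) d"
    have D: "real_diag ?n d' = four_block_mat (mat 1 1 (\<lambda>_. e)) (0\<^sub>m 1 m) (0\<^sub>m m 1) (real_diag m d)"
      using e by (intro eq_matI) (auto simp: real_diag_def d'_def split: nat.splits)
    have "spectral_mat ?n F d' = four_block_mat (mat 1 1 (\<lambda>_. e)) (0\<^sub>m 1 m) (0\<^sub>m m 1) C"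
      unfolding spectral_mat_def adjF D unfolding F_def CV spectral_mat_def using V(1)
      by (simp add: mult_block_diag del: One_nat_def)
    also have "\<dots> = B"
    proof (rule eq_matI)
      fix i j assume "i < dim_row B" "j < dim_col B"
      then have ij: "i < ?n" "j < ?n" using B by auto
      have "B $$ (0, j) = (if j = 0 then e else 0)"
        using B_sym[of 0 j] B_0[OF ij(2)] B_0[of 0] ij by auto
      then show "four_block_mat (mat 1 1 (\<lambda>_. e)) (0\<^sub>m 1 m) (0\<^sub>m m 1) C $$ (i, j) = B $$ (i, j)"
        using ij B_0[OF ij(1)] by (auto simp: C_def)
    qed (use B C in auto)
    finally have "A = U * spectral_mat ?n F d' * mat_adjoint U" by (simp only: AB)
    also have "\<dots> = spectral_mat ?n (U * F) d'"
      using U(1) F unfolding spectral_mat_def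
      by (simp add: adjoint_mult[of _ ?n ?n _ ?n] assoc_mult_mat[of _ ?n ?n _ ?n _ ?n])
    finally show ?case using unitary_mult[OF unU unF] by blast
  qed
  then show ?thesis using that by blast
qed

section \<open>The absolute value of a Hermitian matrix\<close>

text \<open>
  Columns of \<open>U\<close> are unit eigenvectors, so the quadratic form evaluated at them recovers the
  eigenvalues. This is how positive semidefiniteness forces the eigenvalues to be nonnegative.
\<close>

lemma scalar_prod_col_spectral:
  assumes "unitary n U" "k < n"
  shows "(spectral_mat n U d *\<^sub>v col U k) \<bullet>c col U k = complex_of_real (d k)"
proof -
  note U = unitaryD[OF assms(1)]
  have "spectral_mat n U d *\<^sub>v col U k = col (U * real_diag n d) k"
    using U(1) assms(2)
    by (simp flip: spectral_mat_mult_unitary[OF assms(1)] add: col_mult2[of _ n n _ n])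
  then have "(spectral_mat n U d *\<^sub>v col U k) \<bullet>c col U k
      = (\<Sum>i<n. (U * real_diag n d) $$ (i, k) * cnj (U $$ (i, k)))"
    using U(1) assms(2)
    by (auto simp: scalar_prod_def conjugate_complex_def atLeast0LessThan real_diag_def
        intro!: sum.cong)
  also have "\<dots> = d k * (\<Sum>i<n. cnj (U $$ (i, k)) * U $$ (i, k))"
    using U(1) assms(2) by (auto simp: sum_distrib_left mult_real_diag_index intro!: sum.cong)
  finally show ?thesis using unitary_col_orthonormal[OF assms assms(2)] by simp
qed

text \<open>
  In the coordinates \<open>y k\<close> of \<open>x\<close> with respect to the columns of \<open>U\<close>, the quadratic form is the
  sum of \<open>d k * \<bar>y k\<bar>\<^sup>2\<close>.
\<close>

lemma psd_spectral_mat: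
  assumes "unitary n U" "\<And>k. k < n \<Longrightarrow> 0 \<le> d k"
  shows "psd_mat (spectral_mat n U d)"
proof -
  note U = unitaryD[OF assms(1)]
  have "0 \<le> Re ((spectral_mat n U d *\<^sub>v x) \<bullet>c x)" if x: "x \<in> carrier_vec n" for x
  proof -
    let ?y = "\<lambda>k. \<Sum>j<n. cnj (U $$ (j, k)) * x $ j"
    have "(spectral_mat n U d *\<^sub>v x) \<bullet>c x
        = (\<Sum>i<n. (\<Sum>j<n. spectral_mat n U d $$ (i, j) * x $ j) * cnj (x $ i))"
      using x spectral_mat_carrier[OF U(1), of d]
      by (auto simp: scalar_prod_def conjugate_complex_def atLeast0LessThan intro!: sum.cong)
    also have "\<dots> = (\<Sum>i<n. \<Sum>j<n. \<Sum>k<n.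
        d k * ((cnj (U $$ (j, k)) * x $ j) * (U $$ (i, k) * cnj (x $ i))))"
      using U(1) by (auto simp: spectral_mat_index sum_distrib_left sum_distrib_right mult_ac
          intro!: sum.cong)
    also have "\<dots> = (\<Sum>k<n. \<Sum>i<n. \<Sum>j<n.
        d k * ((cnj (U $$ (j, k)) * x $ j) * (U $$ (i, k) * cnj (x $ i))))"
      by (subst sum.swap, subst (2) sum.swap, subst sum.swap, rule sum.cong[OF refl], rule sum.swap)
    also have "\<dots> = (\<Sum>k<n. d k * (?y k * cnj (?y k)))"
    proof (rule sum.cong[OF refl])
      fix k
      have "cnj (?y k) * ?y k
          = (\<Sum>i<n. \<Sum>j<n. (U $$ (i, k) * cnj (x $ i)) * (cnj (U $$ (j, k)) * x $ j))"
        unfolding cnj_sum sum_product by simp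
      then have "d k * (?y k * cnj (?y k))
          = d k * (\<Sum>i<n. \<Sum>j<n. (U $$ (i, k) * cnj (x $ i)) * (cnj (U $$ (j, k)) * x $ j))"
        by (simp only: mult.commute[of "?y k"])
      then show "(\<Sum>i<n. \<Sum>j<n. d k * ((cnj (U $$ (j, k)) * x $ j) * (U $$ (i, k) * cnj (x $ i))))
          = d k * (?y k * cnj (?y k))"
        by (simp add: sum_distrib_left mult_ac)
    qed
    also have "\<dots> = (\<Sum>k<n. complex_of_real (d k * (cmod (?y k))\<^sup>2))"
      unfolding of_real_mult complex_norm_square ..
    finally show ?thesis
      using assms(2) by (auto intro!: sum_nonneg)
  qed
  then show ?thesis
    using adjoint_spectral_mat[OF U(1)] carrier_matD[OF spectral_mat_carrier[OF U(1), of d]]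
    by (simp add: psd_mat_def)
qed

lemma psd_spectral_nonneg:
  assumes "unitary n U" "psd_mat (spectral_mat n U d)" "k < n"
  shows "0 \<le> d k"
proof -
  note U = unitaryD[OF assms(1)]
  have "0 \<le> Re ((spectral_mat n U d *\<^sub>v col U k) \<bullet>c col U k)"
    using assms(2) U(1) assms(3) spectral_mat_carrier[OF U(1), of d]
    by (auto simp: psd_mat_def)
  then show ?thesis by (simp add: scalar_prod_col_spectral[OF assms(1,3)])
qed

text \<open>
  Diagonalise the root \<open>P\<close> by its own unitary matrix \<open>W\<close> with eigenvalues \<open>e\<close>. The change of basis
  \<open>Z\<close> between the two eigenbases intertwines the squares \<open>d\<^sup>2\<close> and \<open>e\<^sup>2\<close>, so a nonzero entry
  \<open>Z(i, j)\<close> forces \<open>(d i)\<^sup>2 = (e j)\<^sup>2\<close>. For nonnegative numbers this means \<open>d i = e j\<close>, so \<open>Z\<close>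
  intertwines \<open>d\<close> and \<open>e\<close> themselves.
\<close>

lemma psd_root_unique:
  assumes U: "unitary n U" and d: "\<And>k. k < n \<Longrightarrow> 0 \<le> d k"
    and P: "P \<in> carrier_mat n n" "psd_mat P" "P * P = spectral_mat n U (\<lambda>k. d k * d k)"
  shows "P = spectral_mat n U d"
proof -
  obtain W e where W: "unitary n W" and PW: "P = spectral_mat n W e"
    using hermitian_spectral_decomposition[OF P(1)] P(2) by (auto simp: psd_mat_def)
  have e: "0 \<le> e k" if "k < n" for k
    using psd_spectral_nonneg[OF W] P(2) that by (simp add: PW)
  note U' = unitaryD[OF U] and W' = unitaryD[OF W]
  define Z where "Z = mat_adjoint U * W"
  have Z: "Z \<in> carrier_mat n n" using U' W' by (simp add: Z_def)
  have "mat_adjoint U * (spectral_mat n U (\<lambda>k. d k * d k) * W) = real_diag n (\<lambda>k. d k * d k) * Z"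
  proof -
    have "mat_adjoint U * (spectral_mat n U (\<lambda>k. d k * d k) * W)
        = (mat_adjoint U * U) * real_diag n (\<lambda>k. d k * d k) * Z"
      using U'(1) W'(1) unfolding spectral_mat_def Z_def
      by (simp add: assoc_mult_mat[of _ n n _ n _ n])
    then show ?thesis using U'(2) by (simp add: left_mult_one_mat[of _ n n])
  qed
  moreover have "mat_adjoint U * (spectral_mat n W (\<lambda>k. e k * e k) * W)
      = Z * real_diag n (\<lambda>k. e k * e k)"
    using U'(1) W'(1) by (simp add: spectral_mat_mult_unitary[OF W] Z_def assoc_mult_mat[of _ n n _ n _ n])
  moreover have "spectral_mat n U (\<lambda>k. d k * d k) = spectral_mat n W (\<lambda>k. e k * e k)"
    using P(3) by (simp add: PW spectral_mat_mult[OF W])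
  ultimately have sq: "real_diag n (\<lambda>k. d k * d k) * Z = Z * real_diag n (\<lambda>k. e k * e k)"
    by simp
  have "real_diag n d * Z = Z * real_diag n e"
  proof (rule eq_matI)
    fix i j assume "i < dim_row (Z * real_diag n e)" "j < dim_col (Z * real_diag n e)"
    then have ij: "i < n" "j < n" using Z by (auto simp: real_diag_def)
    have "complex_of_real (d i * d i) * Z $$ (i, j) = Z $$ (i, j) * complex_of_real (e j * e j)"
      using arg_cong[OF sq, of "\<lambda>M. M $$ (i, j)"] ij Z by (simp add: mult_real_diag_index)
    then have "Z $$ (i, j) = 0 \<or> d i * d i = e j * e j"
      by (metis mult.commute mult_cancel_right of_real_eq_iff)
    then have "Z $$ (i, j) = 0 \<or> d i = e j"
      using d[OF ij(1)] e[OF ij(2)] by (metis power2_eq_imp_eq power2_eq_square)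
    then show "(real_diag n d * Z) $$ (i, j) = (Z * real_diag n e) $$ (i, j)"
      using ij Z by (auto simp: mult_real_diag_index)
  qed (use Z in \<open>auto simp: real_diag_def\<close>)
  then have "U * (real_diag n d * Z) * mat_adjoint W = U * (Z * real_diag n e) * mat_adjoint W"
    by simp
  moreover have "U * (real_diag n d * Z) * mat_adjoint W = spectral_mat n U d * (W * mat_adjoint W)"
    using U'(1) W'(1) unfolding spectral_mat_def Z_def
    by (simp add: assoc_mult_mat[of _ n n _ n _ n])
  moreover have "U * (Z * real_diag n e) * mat_adjoint W = (U * mat_adjoint U) * spectral_mat n W e"
    using U'(1) W'(1) unfolding spectral_mat_def Z_def
    by (simp add: assoc_mult_mat[of _ n n _ n _ n])
  ultimately show ?thesis
    using U' W' by (simp add: PW left_mult_one_mat[of _ n n] right_mult_one_mat[of _ n n])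
qed

theorem abs_spectral_mat:
  assumes U: "unitary n U"
  shows "abs_mat (spectral_mat n U d) = spectral_mat n U (\<lambda>k. \<bar>d k\<bar>)"
proof -
  note U' = unitaryD[OF U]
  let ?S = "spectral_mat n U (\<lambda>k. \<bar>d k\<bar>)"
  have M: "spectral_mat n U d * mat_adjoint (spectral_mat n U d)
      = spectral_mat n U (\<lambda>k. \<bar>d k\<bar> * \<bar>d k\<bar>)"
    using U'(1) by (simp add: adjoint_spectral_mat spectral_mat_mult[OF U])
  have dim: "dim_row (spectral_mat n U (\<lambda>k. \<bar>d k\<bar> * \<bar>d k\<bar>)) = n"
    using spectral_mat_carrier[OF U'(1)] by blast
  show ?thesis
    unfolding abs_mat_def psd_sqrt_def M dim
  proof (rule the_equality)
    show "?S \<in> carrier_mat n n \<and> psd_mat ?S \<and> ?S * ?S = spectral_mat n U (\<lambda>k. \<bar>d k\<bar> * \<bar>d k\<bar>)"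
      using U'(1) psd_spectral_mat[OF U, of "\<lambda>k. \<bar>d k\<bar>"] spectral_mat_mult[OF U] by simp
  qed (use psd_root_unique[OF U, of "\<lambda>k. \<bar>d k\<bar>"] in auto)
qed

section \<open>Eigenvalues counted with multiplicity\<close>

lemma order_prod_linear_factors:
  fixes xs :: "'a :: field list"
  shows "order a (\<Prod>x\<leftarrow>xs. [:- x, 1:]) = count_list xs a"
proof (induction xs)
  case (Cons x xs)
  have "(\<Prod>x\<leftarrow>xs. [:- x, 1:]) \<noteq> 0" by (auto simp: prod_list_zero_iff)
  then have "order a (\<Prod>x\<leftarrow>x # xs. [:- x, 1:]) = order a [:- x, 1:] + count_list xs a"
    by (simp add: order_mult Cons.IH del: mult_pCons_left)
  also have "order a [:- x, 1:] = (if a = x then 1 else 0)"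
    using order_power_n_n[of a 1] by (auto intro!: order_0I)
  finally show ?case by auto
qed (simp add: order_0I)

lemma sum_list_eq_sum_count:
  fixes f :: "'a \<Rightarrow> real"
  shows "sum_list (map f xs) = (\<Sum>x\<in>set xs. real (count_list xs x) * f x)"
proof (induction xs)
  case (Cons x xs)
  let ?g = "\<lambda>y. real (count_list xs y) * f y"
  have "(\<Sum>y\<in>set xs. ?g y) = (\<Sum>y\<in>insert x (set xs). ?g y)"
    by (rule sum.mono_neutral_left) (auto simp: count_list_0_iff)
  moreover have "(\<Sum>y\<in>insert x (set xs). real (count_list (x # xs) y) * f y)
      = (\<Sum>y\<in>insert x (set xs). ?g y + (if y = x then f y else 0))"
    by (intro sum.cong refl) (auto simp: distrib_right)
  ultimately show ?case by (simp add: Cons.IH sum.distrib del: sum.insert_if)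
qed simp

text \<open>
  The characteristic polynomial is invariant under similarity, so it is the product of the linear
  factors at the diagonal entries \<open>d k\<close>. A sum over its distinct roots, weighted by their orders, is
  therefore a sum over all indices \<open>k\<close>.
\<close>

lemma sum_spectrum_spectral_mat:
  fixes f :: "complex \<Rightarrow> real" and d :: "nat \<Rightarrow> real"
  assumes U: "unitary n U"
  defines "A \<equiv> spectral_mat n U d"
  shows "(\<Sum>\<mu>\<in>spectrum A. real (order \<mu> (char_poly A)) * f \<mu>) = (\<Sum>k<n. f (d k))"
proof -
  note U' = unitaryD[OF U]
  let ?D = "real_diag n d"
  let ?es = "map (\<lambda>k. complex_of_real (d k)) [0..<n]"
  have A: "A \<in> carrier_mat n n" using U' by (simp add: A_def)
  have "similar_mat_wit A ?D U (mat_adjoint U)"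
    using U' A by (intro similar_mat_witI[of _ _ n]) (auto simp: A_def spectral_mat_def)
  then have "char_poly A = char_poly ?D"
    by (intro char_poly_similar) (auto simp: similar_mat_def)
  also have "\<dots> = (\<Prod>x\<leftarrow>diag_mat ?D. [:- x, 1:])"
    by (rule char_poly_upper_triangular[of _ n]) (auto simp: real_diag_def)
  also have "diag_mat ?D = ?es"
    by (auto simp: diag_mat_def real_diag_def)
  finally have cp: "char_poly A = (\<Prod>x\<leftarrow>?es. [:- x, 1:])" .
  have "spectrum A = set ?es"
    unfolding spectrum_root_char_poly[OF A] cp by (auto simp: poly_prod_list prod_list_zero_iff)
  then have "(\<Sum>\<mu>\<in>spectrum A. real (order \<mu> (char_poly A)) * f \<mu>)
      = (\<Sum>\<mu>\<in>set ?es. real (count_list ?es \<mu>) * f \<mu>)"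
    unfolding cp order_prod_linear_factors by simp
  also have "\<dots> = sum_list (map f ?es)"
    by (simp only: sum_list_eq_sum_count)
  also have "\<dots> = (\<Sum>k<n. f (d k))"
    by (simp add: o_def interv_sum_list_conv_sum_set_nat atLeast0LessThan)
  finally show ?thesis .
qed

section \<open>The energy inequality\<close>

text \<open>
  Think of \<open>a k l\<close> as the squared modulus of the entry \<open>(k, l)\<close> of an orthogonal projection \<open>P\<close>
  whose diagonal is \<open>q\<close>; then \<open>row\<close> compares the diagonals of \<open>P P\<^sup>*\<close> and \<open>P\<close>,
  and \<open>balance\<close> says that the quadratic form with diagonal matrix \<open>d\<close> vanishes on the columns of
  \<open>P\<close>. The numbers \<open>w k l\<close> in the proof are the squared moduli of the entries of the reflection
  \<open>2 P - 1\<close>, whose rows have norm one. Weighting them by \<open>d k * sgn (d l)\<close>, which is at least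
  \<open>- \<bar>d k\<bar>\<close>, gives the bound.
\<close>

lemma weighted_sum_le_half:
  fixes d q :: "'k \<Rightarrow> real" and a :: "'k \<Rightarrow> 'k \<Rightarrow> real"
  assumes fin: "finite K"
    and nonneg: "\<And>k l. k \<in> K \<Longrightarrow> l \<in> K \<Longrightarrow> 0 \<le> a k l"
    and diag: "\<And>k. k \<in> K \<Longrightarrow> a k k = (q k)\<^sup>2"
    and row: "\<And>k. k \<in> K \<Longrightarrow> (\<Sum>l\<in>K. a k l) = q k"
    and balance: "\<And>l. l \<in> K \<Longrightarrow> (\<Sum>k\<in>K. d k * a k l) = 0"
  shows "(\<Sum>k\<in>K. \<bar>d k\<bar> * q k) \<le> 1 / 2 * (\<Sum>k\<in>K. \<bar>d k\<bar>)"
proof -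
  define w where "w k l = 4 * a k l + (if k = l then 1 - 4 * q k else 0)" for k l
  have w_nonneg: "0 \<le> w k l" if "k \<in> K" "l \<in> K" for k l
  proof (cases "k = l")
    case True
    then have "w k l = (2 * q k - 1)\<^sup>2" using diag[OF that(1)]
      by (simp add: w_def power2_eq_square algebra_simps)
    then show ?thesis by simp
  qed (use nonneg[OF that] in \<open>simp add: w_def\<close>)
  have w_row: "(\<Sum>l\<in>K. w k l) = 1" if "k \<in> K" for k
    using fin that row[OF that] by (simp add: w_def sum.distrib flip: sum_distrib_left)
  have "0 \<le> (\<Sum>k\<in>K. \<Sum>l\<in>K. (\<bar>d k\<bar> + d k * sgn (d l)) * w k l)"
  proof (intro sum_nonneg mult_nonneg_nonneg w_nonneg)
    show "0 \<le> \<bar>d k\<bar> + d k * sgn (d l)" for k l by (auto simp: sgn_if)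
  qed
  also have "\<dots> = (\<Sum>k\<in>K. \<bar>d k\<bar> * (\<Sum>l\<in>K. w k l)) + (\<Sum>k\<in>K. \<Sum>l\<in>K. d k * sgn (d l) * w k l)"
    by (simp add: sum.distrib distrib_right sum_distrib_left)
  also have "(\<Sum>k\<in>K. \<bar>d k\<bar> * (\<Sum>l\<in>K. w k l)) = (\<Sum>k\<in>K. \<bar>d k\<bar>)"
    using w_row by simp
  also have "(\<Sum>k\<in>K. \<Sum>l\<in>K. d k * sgn (d l) * w k l) =
      (\<Sum>l\<in>K. 4 * sgn (d l) * (\<Sum>k\<in>K. d k * a k l)) + (\<Sum>k\<in>K. \<bar>d k\<bar> * (1 - 4 * q k))"
  proof -
    have "(\<Sum>k\<in>K. \<Sum>l\<in>K. d k * sgn (d l) * w k l) =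
        (\<Sum>k\<in>K. \<Sum>l\<in>K. 4 * sgn (d l) * (d k * a k l)) +
        (\<Sum>k\<in>K. \<Sum>l\<in>K. if k = l then d k * sgn (d l) * (1 - 4 * q k) else 0)"
    proof -
      have "d k * sgn (d l) * w k l = 4 * sgn (d l) * (d k * a k l)
          + (if k = l then d k * sgn (d l) * (1 - 4 * q k) else 0)" for k l
        by (simp add: w_def algebra_simps)
      then show ?thesis by (simp only: sum.distrib)
    qed
    also have "(\<Sum>k\<in>K. \<Sum>l\<in>K. 4 * sgn (d l) * (d k * a k l)) =
        (\<Sum>l\<in>K. 4 * sgn (d l) * (\<Sum>k\<in>K. d k * a k l))"
      by (subst sum.swap) (simp add: sum_distrib_left)
    finally show ?thesis using fin by (simp add: abs_sgn)
  qed
  also have "(\<Sum>l\<in>K. 4 * sgn (d l) * (\<Sum>k\<in>K. d k * a k l)) = 0"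
    using balance by simp
  also have "(\<Sum>k\<in>K. \<bar>d k\<bar> * (1 - 4 * q k)) = (\<Sum>k\<in>K. \<bar>d k\<bar>) - 4 * (\<Sum>k\<in>K. \<bar>d k\<bar> * q k)"
    by (simp add: sum_subtractf sum_distrib_left algebra_simps)
  finally show ?thesis by simp
qed

text \<open>
  The hypothesis says that the coordinate subspace spanned by \<open>J\<close> is isotropic for the Hermitian form.
  The numbers \<open>p k l\<close> are the entries of the coordinate projection onto this subspace in the eigenbasis, up
  to complex conjugation. Orthonormality of the rows of \<open>U\<close> makes the projection idempotent, and the
  vanishing of the form on \<open>J\<close> gives the balance condition.
\<close>

theorem trace_abs_isotropic_le_half:
  assumes U: "unitary n U" and J: "J \<subseteq> {..<n}"
    and zero: "\<And>i j. i \<in> J \<Longrightarrow> j \<in> J \<Longrightarrow> spectral_mat n U d $$ (i, j) = 0"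
  shows "(\<Sum>i\<in>J. Re (spectral_mat n U (\<lambda>k. \<bar>d k\<bar>) $$ (i, i))) \<le> 1 / 2 * (\<Sum>k<n. \<bar>d k\<bar>)"
proof -
  note U' = unitaryD[OF U]
  have fin: "finite J" using J finite_subset by blast
  define p where "p k l = (\<Sum>i\<in>J. U $$ (i, k) * cnj (U $$ (i, l)))" for k l
  define q where "q k = (\<Sum>i\<in>J. (cmod (U $$ (i, k)))\<^sup>2)" for k
  have p_sq: "complex_of_real ((cmod (p k l))\<^sup>2) = (\<Sum>i\<in>J. \<Sum>j\<in>J.
      (U $$ (i, k) * cnj (U $$ (j, k))) * (U $$ (j, l) * cnj (U $$ (i, l))))" for k l
    unfolding complex_norm_square p_def cnj_sum sum_product by (simp add: mult_ac)
  have diag: "p k k = complex_of_real (q k)" for k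
    by (simp only: p_def q_def of_real_sum complex_norm_square)
  have row: "(\<Sum>l<n. (cmod (p k l))\<^sup>2) = q k" for k
  proof -
    have "complex_of_real (\<Sum>l<n. (cmod (p k l))\<^sup>2) = (\<Sum>i\<in>J. \<Sum>j\<in>J.
        (U $$ (i, k) * cnj (U $$ (j, k))) * (\<Sum>l<n. U $$ (j, l) * cnj (U $$ (i, l))))"
      unfolding of_real_sum p_sq sum_distrib_left
      by (subst sum.swap, rule sum.cong[OF refl], rule sum.swap)
    also have "\<dots> = (\<Sum>i\<in>J. \<Sum>j\<in>J. if j = i then U $$ (i, k) * cnj (U $$ (j, k)) else 0)"
      using J by (intro sum.cong refl) (auto simp: unitary_row_orthonormal[OF U] subset_iff)
    also have "\<dots> = complex_of_real (q k)"
      using fin by (simp add: p_def flip: diag)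
    finally show ?thesis by (simp only: of_real_eq_iff)
  qed
  have balance: "(\<Sum>k<n. d k * (cmod (p k l))\<^sup>2) = 0" for l
  proof -
    have "complex_of_real (\<Sum>k<n. d k * (cmod (p k l))\<^sup>2) = (\<Sum>i\<in>J. \<Sum>j\<in>J.
        (\<Sum>k<n. d k * (U $$ (i, k) * cnj (U $$ (j, k)))) * (U $$ (j, l) * cnj (U $$ (i, l))))"
      unfolding of_real_sum of_real_mult p_sq sum_distrib_left sum_distrib_right mult.assoc
      by (subst sum.swap, rule sum.cong[OF refl], rule sum.swap)
    also have "\<dots> = (\<Sum>i\<in>J. \<Sum>j\<in>J.
        spectral_mat n U d $$ (i, j) * (U $$ (j, l) * cnj (U $$ (i, l))))"
      using J by (intro sum.cong refl) (auto simp: spectral_mat_index[OF U'(1)] subset_iff)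
    also have "\<dots> = 0" using zero by simp
    finally show ?thesis by (simp only: of_real_eq_0_iff)
  qed
  have "(\<Sum>i\<in>J. Re (spectral_mat n U (\<lambda>k. \<bar>d k\<bar>) $$ (i, i)))
      = (\<Sum>i\<in>J. \<Sum>k<n. \<bar>d k\<bar> * (cmod (U $$ (i, k)))\<^sup>2)"
  proof (rule sum.cong[OF refl])
    fix i assume "i \<in> J"
    then have "i < n" using J by auto
    then show "Re (spectral_mat n U (\<lambda>k. \<bar>d k\<bar>) $$ (i, i)) = (\<Sum>k<n. \<bar>d k\<bar> * (cmod (U $$ (i, k)))\<^sup>2)"
      by (simp add: spectral_mat_index[OF U'(1)] cmod_power2 flip: power2_eq_square)
  qed
  also have "\<dots> = (\<Sum>k<n. \<bar>d k\<bar> * q k)"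
    by (subst sum.swap) (simp add: q_def sum_distrib_left)
  also have "\<dots> \<le> 1 / 2 * (\<Sum>k<n. \<bar>d k\<bar>)"
    by (rule weighted_sum_le_half[where a = "\<lambda>k l. (cmod (p k l))\<^sup>2"])
      (use row balance in \<open>simp_all add: diag\<close>)
  finally show ?thesis .
qed

lemma adjoint_adjacency_mat:
  assumes "pair_graph G"
  shows "mat_adjoint (adjacency_mat G vs) = adjacency_mat G vs"
proof -
  interpret pair_graph G by fact
  have "(u, w) \<in> parcs G \<longleftrightarrow> (w, u) \<in> parcs G" for u w
    using arcs_symmetric by blast
  then show ?thesis
    by (intro eq_matI) (auto simp: adjacency_mat_def conjugate_complex_def)
qed

theorem corollary4p7:
  fixes G :: "'a pair_pre_digraph" and vs :: "'a list" and I :: "'a set"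
  assumes "pair_graph G"
    and "distinct vs" and "set vs = pverts G"
    and "bipartite G"
    and "independent_set G I"
  shows "1 / 2 * graph_energy G vs \<ge> (\<Sum>i | i < length vs \<and> vs ! i \<in> I. vertex_energy G vs i)"
proof -
  let ?n = "length vs"
  let ?A = "adjacency_mat G vs"
  let ?J = "{i. i < ?n \<and> vs ! i \<in> I}"
  have "?A \<in> carrier_mat ?n ?n" by (simp add: adjacency_mat_def)
  then obtain U d where U: "unitary ?n U" and A: "?A = spectral_mat ?n U d"
    using hermitian_spectral_decomposition adjoint_adjacency_mat[OF assms(1)] by blast
  have "spectral_mat ?n U d $$ (i, j) = 0" if "i \<in> ?J" "j \<in> ?J" for i j
    using that assms(5) unfolding A[symmetric] by (auto simp: adjacency_mat_def independent_set_def)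
  then have "(\<Sum>i\<in>?J. Re (spectral_mat ?n U (\<lambda>k. \<bar>d k\<bar>) $$ (i, i))) \<le> 1 / 2 * (\<Sum>k<?n. \<bar>d k\<bar>)"
    by (intro trace_abs_isotropic_le_half[OF U]) auto
  moreover have "graph_energy G vs = (\<Sum>k<?n. \<bar>d k\<bar>)"
    unfolding graph_energy_def Let_def A sum_spectrum_spectral_mat[OF U] by simp
  ultimately show ?thesis
    by (simp add: vertex_energy_def A abs_spectral_mat[OF U])
qed

end
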